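(* Consider a (possibly dependent) sequence $X_1,X_2,\ldots$ of random variables with common continuous distribution function $F$, let $M_n=\max(X_1,\dots,X_n)$, and assume the following conditions hold. (i) There exist a generalized extreme value distribution function $H$, sequences $(c_n^* )$, $c_n^*>0$, and $(d_n^* )$, and a map $\beta^*:\mathbb{N}\to[0,\infty)$ satisfying $\beta^*(n)\to0$ as $n\to\infty$ such that $\sup_{x\in\mathbb{R}}|F^n(c_n^*x+d_n^* )-H(x)|\le\beta^*(n)$. (ii) There exist a rate $r:\mathbb{N}\to(0,\infty)$ with $r_n\to\infty$ as $n\to\infty$ and functions $D:[0,1]\to[0,1]$ and $s:\mathbb{N}\to[0,\infty)$ with $s(n)\to0$ as $n\to\infty$ such that the diagonal power distortion $D_n^r$ corresponding to $r$ satisfies $\sup_{u\in[0,1]}|D_n^r(u)-D(u)|\le s(n)$. (iii) The limit $D$ in (ii) is Hölder continuous with constant $K$ and parameter $0<\kappa\le1$. Then $$\sup_{x\in\mathbb{R}}\left|\mathbb{P}(M_n\le c^*_{\lceil r_n\rceil}x+d^*_{\lceil r_n\rceil})-D\circ H(x)\right|\le K\left\{\beta^*(\lceil r_n\rceil)+3e^{-1}\mathbf{1}_{\{r_n\notin\mathbb{N}\}}/r_n\right\}^{\kappa}+s(n),$$ where the right-hand side converges to $0$ as $n\to\infty$.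
   Context: Since $F$ is continuous, for each $n$ there is a unique copula $C_n$ (a distribution function on $[0,1]^n$ with standard uniform univariate margins) with $\mathbb{P}(X_1\le x_1,\dots,X_n\le x_n)=C_n(F(x_1),\dots,F(x_n))$. Its diagonal is $\delta_n(u)=C_n(u,\dots,u)$, $u\in[0,1]$. For a rate $r:\mathbb{N}\to(0,\infty)$ (write $r_n=r(n)$), the diagonal power distortion is $D_n^r:[0,1]\to[0,1]$, $D_n^r(u)=\delta_n(u^{1/r_n})$. Hölder continuity of $D$ with constant $K$ and parameter $\kappa$ means $|D(u)-D(v)|\le K|u-v|^\kappa$ for all $u,v\in[0,1]$. $\mathbf{1}$ denotes an indicator and $\lceil\cdot\rceil$ the ceiling function. Generalized extreme value (GEV) distribution functions are $H_{\xi,\mu,\sigma}$ with $\xi,\mu\in\mathbb{R}$, $\sigma>0$: $H_{\xi,\mu,\sigma}(x)=\exp(-(1+\xi(x-\mu)/\sigma)^{-1/\xi})$ if $\xi\ne0$ and $\exp(-e^{-(x-\mu)/\sigma})$ if $\xi=0$, for all $x$ with $1+\xi(x-\mu)/\sigma>0$, and the corresponding limiting value $0$ or $1$ otherwise. *)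

theory Defs
  imports "HOL-Probability.Probability"
begin

section \<open>Copulas\<close>

text \<open>Points of the \<open>n\<close>-dimensional unit cube are functions on \<open>{1..n}\<close>, extensional outside of it.\<close>

definition unit_cube :: "nat \<Rightarrow> (nat \<Rightarrow> real) set" where
  "unit_cube n = (\<Pi>\<^sub>E i\<in>{1..n}. {0..1})"

text \<open>
  A copula is the restriction to the unit cube of the distribution function of a probability
  measure on \<open>\<real>\<^sup>n\<close> all of whose univariate margins are uniform on \<open>[0,1]\<close>.  Extensionality only
  fixes the irrelevant values outside the cube, so that uniqueness can hold as equality of functions.
\<close>

definition is_copula :: "nat \<Rightarrow> ((nat \<Rightarrow> real) \<Rightarrow> real) \<Rightarrow> bool" where
  "is_copula n C \<longleftrightarrow>
     C \<in> extensional (unit_cube n) \<and>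
     (\<exists>Q. prob_space Q \<and> sets Q = sets (\<Pi>\<^sub>M i\<in>{1..n}. borel) \<and>
          (\<forall>i\<in>{1..n}. distr Q borel (\<lambda>\<omega>. \<omega> i) = uniform_measure lborel {0..1}) \<and>
          (\<forall>u\<in>unit_cube n. C u = measure Q {\<omega> \<in> space Q. \<forall>i\<in>{1..n}. \<omega> i \<le> u i}))"

definition copula_of ::
  "'a measure \<Rightarrow> (nat \<Rightarrow> 'a \<Rightarrow> real) \<Rightarrow> (real \<Rightarrow> real) \<Rightarrow> nat \<Rightarrow> (nat \<Rightarrow> real) \<Rightarrow> real" where
  "copula_of M X F n =
     (THE C. is_copula n C \<and>
        (\<forall>x. measure M {\<omega> \<in> space M. \<forall>i\<in>{1..n}. X i \<omega> \<le> x i} = C (\<lambda>i\<in>{1..n}. F (x i))))"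

definition copula_diagonal :: "nat \<Rightarrow> ((nat \<Rightarrow> real) \<Rightarrow> real) \<Rightarrow> real \<Rightarrow> real" where
  "copula_diagonal n C u = C (\<lambda>i\<in>{1..n}. u)"

definition diagonal_power_distortion ::
  "'a measure \<Rightarrow> (nat \<Rightarrow> 'a \<Rightarrow> real) \<Rightarrow> (real \<Rightarrow> real) \<Rightarrow> (nat \<Rightarrow> real) \<Rightarrow> nat \<Rightarrow> real \<Rightarrow> real" where
  "diagonal_power_distortion M X F r n u = copula_diagonal n (copula_of M X F n) (u powr (1 / r n))"


section \<open>Maxima, extreme value distributions, and Hoelder continuity\<close>

definition running_max :: "(nat \<Rightarrow> 'a \<Rightarrow> real) \<Rightarrow> nat \<Rightarrow> 'a \<Rightarrow> real" where
  "running_max X n \<omega> = Max ((\<lambda>i. X i \<omega>) ` {1..n})"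

definition gev_cdf :: "real \<Rightarrow> real \<Rightarrow> real \<Rightarrow> real \<Rightarrow> real" where
  "gev_cdf \<xi> \<mu> \<sigma> x =
     (if \<xi> = 0 then exp (- exp (- (x - \<mu>) / \<sigma>))
      else if 1 + \<xi> * (x - \<mu>) / \<sigma> > 0 then exp (- ((1 + \<xi> * (x - \<mu>) / \<sigma>) powr (- 1 / \<xi>)))
      else if \<xi> > 0 then 0 else 1)"

definition holder_continuous_on :: "real set \<Rightarrow> (real \<Rightarrow> real) \<Rightarrow> real \<Rightarrow> real \<Rightarrow> bool" where
  "holder_continuous_on S f K \<kappa> \<longleftrightarrow> (\<forall>u\<in>S. \<forall>v\<in>S. \<bar>f u - f v\<bar> \<le> K * \<bar>u - v\<bar> powr \<kappa>)"


section \<open>Existence and uniqueness of the copula for a continuous margin\<close>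

lemma cdf_uniform_01:
  "measure (uniform_measure lborel {0..1::real}) {..u} = (if u < 0 then 0 else if u \<le> 1 then u else 1)"
proof -
  have "{0..1} \<inter> {..u} = (if u < 0 then {} else if u \<le> 1 then {0..u} else {0..1})"
    by auto
  then show ?thesis
    by (subst measure_uniform_measure) auto
qed

lemma cdf_attains:
  assumes M: "prob_space M" and X: "X \<in> borel_measurable M"
    and F: "F = cdf (distr M borel X)" and cont: "continuous_on UNIV F"
    and u: "0 < u" "u < 1"
  obtains y where "F y = u"
proof -
  interpret D: real_distribution "distr M borel X"
    using M X by (simp add: prob_space.real_distribution_distr)
  have "eventually (\<lambda>x. F x < u) at_bot"
    using D.cdf_lim_at_bot u unfolding F by (intro order_tendstoD) auto
  then obtain a where a: "F a < u" by (auto simp: eventually_at_bot_linorder)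
  have "eventually (\<lambda>x. F x > u) at_top"
    using D.cdf_lim_at_top_prob u unfolding F by (intro order_tendstoD) auto
  then obtain b where b: "F b > u" by (auto simp: eventually_at_top_linorder)
  have "a \<le> b"
    using a b D.cdf_nondecreasing[of b a] unfolding F by linarith
  then show thesis
    using IVT'[of F a u b] a b continuous_on_subset[OF cont, of "{a..b}"] that by auto
qed

lemma distr_probability_integral_transform:
  assumes M: "prob_space M" and X: "X \<in> borel_measurable M"
    and F: "F = cdf (distr M borel X)" and cont: "continuous_on UNIV F"
  shows "distr M borel (\<lambda>\<omega>. F (X \<omega>)) = uniform_measure lborel {0..1}"
proof -
  interpret prob_space M by (rule M)
  interpret D: real_distribution "distr M borel X"
    using X by simp
  have Fm[measurable]: "F \<in> borel_measurable borel"
    using cont by (rule borel_measurable_continuous_onI)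
  note X[measurable]
  interpret E: real_distribution "distr M borel (\<lambda>\<omega>. F (X \<omega>))"
    by simp
  have "prob_space (uniform_measure lborel {0..1::real})"
    by (rule prob_space_uniform_measure) auto
  then interpret U: real_distribution "uniform_measure lborel {0..1::real}"
    by (simp add: real_distribution_def real_distribution_axioms_def)
  have FX: "F x = prob {\<omega> \<in> space M. X \<omega> \<le> x}" for x
    by (simp add: F cdf_def measure_distr vimage_def Int_def conj_commute)
  have F01: "0 \<le> F x" "F x \<le> 1" for x by (auto simp: FX)
  have mono: "F x \<le> F y" if "x \<le> y" for x y
    using D.cdf_nondecreasing that F by auto
  have main: "prob {\<omega> \<in> space M. F (X \<omega>) \<le> u} = (if u < 0 then 0 else if u \<le> 1 then u else 1)" for u
  proof -
    consider "u < 0" | "0 \<le> u" "u < 1" | "u \<ge> 1" by linarith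
    then show ?thesis
    proof cases
      case 1
      then have "{\<omega> \<in> space M. F (X \<omega>) \<le> u} = {}" using F01 by (smt (verit) Collect_empty_eq)
      then show ?thesis using 1 by (simp only: measure_empty if_True)
    next
      case 3
      then have "{\<omega> \<in> space M. F (X \<omega>) \<le> u} = space M" using F01(2) by (auto intro: order_trans)
      with 3 show ?thesis by (simp add: prob_space)
    next
      case 2
      have "u \<le> prob {\<omega> \<in> space M. F (X \<omega>) \<le> u}"
      proof (cases "u = 0")
        case False
        then obtain y where y: "F y = u"
          using cdf_attains[OF M X F cont] 2 by (metis order_le_less)
        have "F y \<le> prob {\<omega> \<in> space M. F (X \<omega>) \<le> u}"
          unfolding FX[of y] using y mono by (intro finite_measure_mono) auto
        with y show ?thesis by simp
      qed simp
      moreover have "prob {\<omega> \<in> space M. F (X \<omega>) \<le> u} \<le> u"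
      proof (rule dense_ge_bounded[OF 2(2)])
        fix v assume v: "u < v" "v < 1"
        then obtain z where z: "F z = v"
          using cdf_attains[OF M X F cont, of v] 2 by auto
        have "prob {\<omega> \<in> space M. F (X \<omega>) \<le> u} \<le> F z"
          unfolding FX[of z] using z v mono
          by (intro finite_measure_mono) (auto, smt (verit))
        with z show "prob {\<omega> \<in> space M. F (X \<omega>) \<le> u} \<le> v" by simp
      qed
      ultimately show ?thesis using 2 by simp
    qed
  qed
  show ?thesis
  proof (rule cdf_unique)
    show "real_distribution (distr M borel (\<lambda>\<omega>. F (X \<omega>)))" by unfold_locales
    show "real_distribution (uniform_measure lborel {0..1::real})" by unfold_locales
    show "cdf (distr M borel (\<lambda>\<omega>. F (X \<omega>))) = cdf (uniform_measure lborel {0..1})"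
    proof
      fix u
      have "cdf (distr M borel (\<lambda>\<omega>. F (X \<omega>))) u = prob {\<omega> \<in> space M. F (X \<omega>) \<le> u}"
        by (simp add: cdf_def measure_distr vimage_def Int_def conj_commute)
      then show "cdf (distr M borel (\<lambda>\<omega>. F (X \<omega>))) u = cdf (uniform_measure lborel {0..1}) u"
        unfolding main by (simp add: cdf_def cdf_uniform_01)
    qed
  qed
qed

lemma copula_measure_lipschitz:
  fixes u v :: "nat \<Rightarrow> real"
  assumes Q: "prob_space Q" and sets_Q: "sets Q = sets (\<Pi>\<^sub>M i\<in>{1..n}. borel)"
    and marg: "\<forall>i\<in>{1..n}. distr Q borel (\<lambda>\<omega>. \<omega> i) = uniform_measure lborel {0..1}"
    and u: "u \<in> unit_cube n" and v: "v \<in> unit_cube n"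
  shows "measure Q {\<omega> \<in> space Q. \<forall>i\<in>{1..n}. \<omega> i \<le> u i}
           \<le> measure Q {\<omega> \<in> space Q. \<forall>i\<in>{1..n}. \<omega> i \<le> v i} + (\<Sum>i\<in>{1..n}. \<bar>u i - v i\<bar>)"
proof -
  interpret prob_space Q by (rule Q)
  have comp[measurable]: "(\<lambda>\<omega>. \<omega> i) \<in> borel_measurable Q" if "i \<in> {1..n}" for i
    using that by (subst measurable_cong_sets[OF sets_Q refl]) (rule measurable_component_singleton)
  have S[measurable]: "{\<omega> \<in> space Q. \<omega> i \<le> a} \<in> sets Q" if "i \<in> {1..n}" for i and a :: real
    using comp[OF that] by measurable
  have A[measurable]: "{\<omega> \<in> space Q. \<forall>i\<in>{1..n}. \<omega> i \<le> w i} \<in> sets Q" for w :: "nat \<Rightarrow> real"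
    using S by (intro sets.sets_Collect_finite_All) auto
  define B where "B i = {\<omega> \<in> space Q. \<omega> i \<le> u i} - {\<omega> \<in> space Q. \<omega> i \<le> v i}" for i
  have B[measurable]: "B i \<in> sets Q" if "i \<in> {1..n}" for i
    using S[OF that] unfolding B_def by auto
  have m: "prob {\<omega> \<in> space Q. \<omega> i \<le> a} = a" if "i \<in> {1..n}" "0 \<le> a" "a \<le> 1" for i a
  proof -
    have "prob {\<omega> \<in> space Q. \<omega> i \<le> a} = measure (distr Q borel (\<lambda>\<omega>. \<omega> i)) {..a}"
      using comp[OF that(1)] by (simp add: measure_distr vimage_def Int_def conj_commute)
    with that marg show ?thesis by (simp add: cdf_uniform_01)
  qed
  have pB: "prob (B i) \<le> \<bar>u i - v i\<bar>" if i: "i \<in> {1..n}" for i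
  proof (cases "u i \<le> v i")
    case True
    then have "B i = {}" by (auto simp: B_def)
    then show ?thesis by simp
  next
    case False
    have uv: "u i \<in> {0..1}" "v i \<in> {0..1}"
      using u v i by (auto simp: unit_cube_def PiE_iff)
    have "prob (B i) = u i - v i"
      unfolding B_def using S[OF i] False m[OF i] uv
      by (subst finite_measure_Diff) auto
    then show ?thesis by simp
  qed
  have "prob {\<omega> \<in> space Q. \<forall>i\<in>{1..n}. \<omega> i \<le> u i}
          \<le> prob ({\<omega> \<in> space Q. \<forall>i\<in>{1..n}. \<omega> i \<le> v i} \<union> (\<Union>i\<in>{1..n}. B i))"
    using A B by (intro finite_measure_mono sets.Un sets.finite_UN) (auto simp: B_def)
  also have "\<dots> \<le> prob {\<omega> \<in> space Q. \<forall>i\<in>{1..n}. \<omega> i \<le> v i} + prob (\<Union>i\<in>{1..n}. B i)"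
    using A B by (intro measure_Un_le sets.finite_UN) auto
  also have "prob (\<Union>i\<in>{1..n}. B i) \<le> (\<Sum>i\<in>{1..n}. prob (B i))"
    using B by (intro finite_measure_subadditive_finite) auto
  also have "\<dots> \<le> (\<Sum>i\<in>{1..n}. \<bar>u i - v i\<bar>)"
    by (intro sum_mono pB)
  finally show ?thesis by simp
qed

lemma copula_lipschitz:
  assumes "is_copula n C" "u \<in> unit_cube n" "v \<in> unit_cube n"
  shows "\<bar>C u - C v\<bar> \<le> (\<Sum>i\<in>{1..n}. \<bar>u i - v i\<bar>)"
proof -
  from assms(1) obtain Q where Q: "prob_space Q" "sets Q = sets (\<Pi>\<^sub>M i\<in>{1..n}. borel)"
      "\<forall>i\<in>{1..n}. distr Q borel (\<lambda>\<omega>. \<omega> i) = uniform_measure lborel {0..1}"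
    and C: "\<forall>u\<in>unit_cube n. C u = measure Q {\<omega> \<in> space Q. \<forall>i\<in>{1..n}. \<omega> i \<le> u i}"
    unfolding is_copula_def by blast
  show ?thesis
    using copula_measure_lipschitz[OF Q assms(2,3)] copula_measure_lipschitz[OF Q assms(3,2)] C assms(2,3)
    by (simp add: abs_minus_commute abs_le_iff)
qed

lemma copula_ex1:
  fixes X :: "nat \<Rightarrow> 'a \<Rightarrow> real"
  assumes M: "prob_space M" and n: "n \<ge> 1"
    and X: "\<And>i. i \<ge> 1 \<Longrightarrow> X i \<in> borel_measurable M"
    and F: "\<And>i. i \<ge> 1 \<Longrightarrow> cdf (distr M borel (X i)) = F" and cont: "continuous_on UNIV F"
  shows "\<exists>!C. is_copula n C \<and>
    (\<forall>x. measure M {\<omega> \<in> space M. \<forall>i\<in>{1..n}. X i \<omega> \<le> x i} = C (\<lambda>i\<in>{1..n}. F (x i)))"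
proof (rule ex_ex1I)
  interpret prob_space M by (rule M)
  have Fm[measurable]: "F \<in> borel_measurable borel"
    using cont by (rule borel_measurable_continuous_onI)
  have FX: "F x = prob {\<omega> \<in> space M. X i \<omega> \<le> x}" if "i \<ge> 1" for x i
    using X[OF that] by (simp add: F[OF that, symmetric] cdf_def measure_distr vimage_def Int_def conj_commute)
  have F01: "0 \<le> F x" "F x \<le> 1" for x by (auto simp: FX[of 1])
  have U: "distr M borel (\<lambda>\<omega>. F (X i \<omega>)) = uniform_measure lborel {0..1}" if "i \<ge> 1" for i
    by (rule distr_probability_integral_transform[OF M X[OF that] F[OF that, symmetric] cont])
  have mono: "F x \<le> F y" if "x \<le> y" for x y
    unfolding FX[of 1, simplified] using that X[of 1] by (intro finite_measure_mono) auto
  define T where "T \<omega> = (\<lambda>i\<in>{1..n}. F (X i \<omega>))" for \<omega>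
  define Q where "Q = distr M (\<Pi>\<^sub>M i\<in>{1..n}. borel) T"
  define C where "C = restrict (\<lambda>u. measure Q {\<omega> \<in> space Q. \<forall>i\<in>{1..n}. \<omega> i \<le> u i}) (unit_cube n)"
  have FXm: "(\<lambda>\<omega>. F (X i \<omega>)) \<in> borel_measurable M" if "i \<ge> 1" for i
    using X[OF that] by measurable
  have T[measurable]: "T \<in> measurable M (\<Pi>\<^sub>M i\<in>{1..n}. borel)"
    unfolding T_def using FXm by (intro measurable_restrict) auto
  have comp: "(\<lambda>\<omega>. \<omega> i) \<in> borel_measurable (\<Pi>\<^sub>M i\<in>{1..n}. (borel :: real measure))" if "i \<in> {1..n}" for i
    using that by (rule measurable_component_singleton)
  have marg: "distr Q borel (\<lambda>\<omega>. \<omega> i) = uniform_measure lborel {0..1}" if i: "i \<in> {1..n}" for i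
  proof -
    have "distr Q borel (\<lambda>\<omega>. \<omega> i) = distr M borel ((\<lambda>\<omega>. \<omega> i) \<circ> T)"
      unfolding Q_def by (rule distr_distr[OF comp[OF i] T])
    also have "(\<lambda>\<omega>. \<omega> i) \<circ> T = (\<lambda>\<omega>. F (X i \<omega>))"
      using i by (auto simp: T_def)
    finally show ?thesis using U i by simp
  qed
  have cop: "is_copula n C"
    unfolding is_copula_def
  proof (intro conjI exI[of _ Q] ballI)
    show "prob_space Q" unfolding Q_def by (rule prob_space_distr[OF T])
  qed (auto simp: C_def Q_def[THEN arg_cong[of _ _ sets]] intro!: marg)
  have sk: "prob {\<omega> \<in> space M. \<forall>i\<in>{1..n}. X i \<omega> \<le> x i} = C (\<lambda>i\<in>{1..n}. F (x i))" for x
  proof -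
    have ae: "AE \<omega> in M. X i \<omega> \<le> x i \<longleftrightarrow> F (X i \<omega>) \<le> F (x i)" if i: "i \<ge> 1" for i
    proof -
      note X[OF i, measurable]
      have sub: "{\<omega> \<in> space M. X i \<omega> \<le> x i} \<subseteq> {\<omega> \<in> space M. F (X i \<omega>) \<le> F (x i)}"
        using mono by auto
      have "prob {\<omega> \<in> space M. F (X i \<omega>) \<le> F (x i)}
              = measure (distr M borel (\<lambda>\<omega>. F (X i \<omega>))) {..F (x i)}"
        by (simp add: measure_distr vimage_def Int_def conj_commute)
      also have "\<dots> = prob {\<omega> \<in> space M. X i \<omega> \<le> x i}"
        using F01[of "x i"] FX[OF i, of "x i"] by (simp add: U[OF i] cdf_uniform_01)
      finally have "prob ({\<omega> \<in> space M. F (X i \<omega>) \<le> F (x i)} - {\<omega> \<in> space M. X i \<omega> \<le> x i}) = 0"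
        using sub by (subst finite_measure_Diff) auto
      then have "AE \<omega> in M. \<omega> \<notin> {\<omega> \<in> space M. F (X i \<omega>) \<le> F (x i)} - {\<omega> \<in> space M. X i \<omega> \<le> x i}"
        by (subst (asm) prob_eq_0) auto
      then show ?thesis using mono by (auto elim!: eventually_mono)
    qed
    have cube: "(\<lambda>i\<in>{1..n}. F (x i)) \<in> unit_cube n"
      using F01 by (auto simp: unit_cube_def)
    have B: "{\<omega> \<in> space (\<Pi>\<^sub>M i\<in>{1..n}. (borel::real measure)). \<forall>i\<in>{1..n}. \<omega> i \<le> F (x i)}
               \<in> sets (\<Pi>\<^sub>M i\<in>{1..n}. borel)"
    proof (intro sets.sets_Collect_finite_All)
      show "{\<omega> \<in> space (\<Pi>\<^sub>M i\<in>{1..n}. (borel::real measure)). \<omega> i \<le> F (x i)}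
              \<in> sets (\<Pi>\<^sub>M i\<in>{1..n}. borel)" if "i \<in> {1..n}" for i
        using comp[OF that] by measurable
    qed simp
    have Ms: "{\<omega> \<in> space M. \<forall>i\<in>{1..n}. g i \<omega> \<le> c i} \<in> sets M"
      if "\<And>i. i \<ge> 1 \<Longrightarrow> g i \<in> borel_measurable M" for g :: "nat \<Rightarrow> 'a \<Rightarrow> real" and c
    proof (intro sets.sets_Collect_finite_All)
      show "{\<omega> \<in> space M. g i \<omega> \<le> c i} \<in> sets M" if "i \<in> {1..n}" for i
        proof -
        have [measurable]: "g i \<in> borel_measurable M"
          using \<open>\<And>i. i \<ge> 1 \<Longrightarrow> g i \<in> borel_measurable M\<close> that by auto
        show ?thesis by measurable
      qed
    qed simp
    have "AE \<omega> in M. \<forall>i\<in>{1..n}. X i \<omega> \<le> x i \<longleftrightarrow> F (X i \<omega>) \<le> F (x i)"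
      using ae by (intro AE_finite_allI) auto
    then have "prob {\<omega> \<in> space M. \<forall>i\<in>{1..n}. X i \<omega> \<le> x i}
                 = prob {\<omega> \<in> space M. \<forall>i\<in>{1..n}. F (X i \<omega>) \<le> F (x i)}"
      by (intro finite_measure_eq_AE Ms X FXm) (auto elim!: eventually_mono)
    also have "\<dots> = measure Q {\<omega> \<in> space Q. \<forall>i\<in>{1..n}. \<omega> i \<le> F (x i)}"
      unfolding Q_def space_distr using measurable_space[OF T]
      by (subst measure_distr[OF T B]) (auto simp: T_def intro!: arg_cong[of _ _ prob])
    finally show ?thesis using cube by (simp add: C_def)
  qed
  show "\<exists>C. is_copula n C \<and>
    (\<forall>x. prob {\<omega> \<in> space M. \<forall>i\<in>{1..n}. X i \<omega> \<le> x i} = C (\<lambda>i\<in>{1..n}. F (x i)))"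
    using cop sk by blast

  fix C1 C2
  assume C1: "is_copula n C1 \<and>
      (\<forall>x. prob {\<omega> \<in> space M. \<forall>i\<in>{1..n}. X i \<omega> \<le> x i} = C1 (\<lambda>i\<in>{1..n}. F (x i)))"
    and C2: "is_copula n C2 \<and>
      (\<forall>x. prob {\<omega> \<in> space M. \<forall>i\<in>{1..n}. X i \<omega> \<le> x i} = C2 (\<lambda>i\<in>{1..n}. F (x i)))"
  have "C1 u = C2 u" if u: "u \<in> unit_cube n" for u
  proof -
    have u01: "0 \<le> u i" "u i \<le> 1" if "i \<in> {1..n}" for i
      using u that by (auto simp: unit_cube_def PiE_iff)
    have "\<bar>C1 u - C2 u\<bar> \<le> 0"
    proof (rule dense_ge_bounded[of 0 "real n"])
      fix w assume w: "0 < w" "w < real n"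
      define e where "e = w / real n"
      have e: "0 < e" "e < 1" using w n by (auto simp: e_def)
      define v where "v = (\<lambda>i\<in>{1..n}. u i + e * (1/2 - u i))"
      have v: "0 < v i" "v i < 1" "\<bar>u i - v i\<bar> \<le> e / 2" if i: "i \<in> {1..n}" for i
      proof -
        have eq: "v i = (1 - e) * u i + e / 2" using i by (simp add: v_def algebra_simps)
        have "0 \<le> (1 - e) * u i" "(1 - e) * u i \<le> 1 - e"
          using e u01[OF i] by (simp_all add: mult_left_le)
        then show "0 < v i" "v i < 1" using e unfolding eq by linarith+
        have "\<bar>u i - v i\<bar> = e * \<bar>1/2 - u i\<bar>" using i e by (simp add: v_def abs_mult)
        also have "\<dots> \<le> e * (1/2)"
          using e u01[OF i] by (intro mult_left_mono; linarith)
        finally show "\<bar>u i - v i\<bar> \<le> e / 2" by simp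
      qed
      have vc: "v \<in> unit_cube n"
        using v(1,2) by (auto simp: unit_cube_def PiE_iff less_imp_le v_def)
      have "\<exists>y. F y = v i" if "i \<in> {1..n}" for i
        using cdf_attains[OF M X F[symmetric] cont, of 1 "v i"] v(1,2)[OF that] by auto
      then obtain y where y: "\<And>i. i \<in> {1..n} \<Longrightarrow> F (y i) = v i" by metis
      have "(\<lambda>i\<in>{1..n}. F (y i)) = v"
        using y by (auto simp: v_def fun_eq_iff)
      then have eq: "C1 v = C2 v" using C1 C2 by metis
      have "(\<Sum>i\<in>{1..n}. \<bar>u i - v i\<bar>) \<le> (\<Sum>i\<in>{1..n}. e / 2)"
        using v(3) by (intro sum_mono) auto
      also have "\<dots> = w / 2" using n by (simp add: e_def)
      finally have s: "(\<Sum>i\<in>{1..n}. \<bar>u i - v i\<bar>) \<le> w / 2" .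
      have "\<bar>C1 u - C1 v\<bar> \<le> w / 2" "\<bar>C2 u - C2 v\<bar> \<le> w / 2"
        using copula_lipschitz[of n C1 u v] copula_lipschitz[of n C2 u v] C1 C2 u vc s by auto
      then show "\<bar>C1 u - C2 u\<bar> \<le> w" using eq by linarith
    qed (use n in auto)
    then show ?thesis by simp
  qed
  then show "C1 = C2"
    using C1 C2 by (intro extensionalityI[of C1 "unit_cube n" C2]) (auto simp: is_copula_def)
qed

end

(* Since the copula represents the law of the maximum, P(M_n <= y) = D_n(F(y)^r) with r = r_n, so
   the error splits into the distortion error s(n) and |D(F^r) - D(H)| <= K |F^r - H|^kappa.
   Writing u = exp(-t) and R = ceiling(r), replacing the exponent r by R costs
   u^r - u^R <= t exp(-r t) <= 1 / (e r), which is even better than the factor 3 claimed. *)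

theory Submission
  imports Defs
begin

text \<open>With \<open>t = - ln u\<close>, the gap factors as \<open>exp (- (r * t))\<close> times
  \<open>1 - exp (- ((R - r) * t))\<close>. The second factor is at most \<open>(R - r) * t\<close>,
  hence at most \<open>t\<close>, which is where \<open>R \<le> r + 1\<close> enters.\<close>

lemma powr_diff_le_inverse_exponent:
  fixes u r R :: real
  assumes u: "0 \<le> u" "u \<le> 1" and r: "0 < r" "r \<le> R" "R \<le> r + 1"
  shows "\<bar>u powr r - u powr R\<bar> \<le> exp (- 1) / r"
proof (cases "u = 0")
  \<comment> \<open>The logarithm needs \<open>u\<close> positive; at \<open>u = 0\<close> both
    powers are 0 because \<open>0 powr a = 0\<close> for every \<open>a\<close>.\<close>
  case False
  define t where "t = - ln u"
  have t: "0 \<le> t" using u False by (simp add: t_def)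
  have ut: "u powr a = exp (- (a * t))" for a
    using False by (simp add: powr_def t_def)
  have split: "exp (- (R * t)) = exp (- (r * t)) * exp (- ((R - r) * t))"
    by (simp add: algebra_simps flip: exp_add)
  have "0 \<le> u powr r - u powr R"
    using t r by (simp add: ut mult_right_mono)
  moreover have "u powr r - u powr R \<le> exp (- (r * t)) * t"
  proof -
    have "1 - exp (- ((R - r) * t)) \<le> (R - r) * t"
      using exp_ge_add_one_self[of "- ((R - r) * t)"] by linarith
    also have "\<dots> \<le> 1 * t"
      using r t by (intro mult_right_mono) auto
    finally have "exp (- (r * t)) * (1 - exp (- ((R - r) * t))) \<le> exp (- (r * t)) * t"
      by (intro mult_left_mono) auto
    then show ?thesis unfolding ut split by (simp add: algebra_simps)
  qed
  moreover have "exp (- (r * t)) * t \<le> exp (- 1) / r"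
  proof -
    \<comment> \<open>The tangent bound \<open>x \<le> exp (x - 1)\<close> at
      \<open>x = r * t\<close> yields the maximum of \<open>t * exp (- (r * t))\<close>, attained at
      \<open>t = 1 / r\<close>, without differentiation.\<close>
    have "r * t \<le> exp (r * t - 1)"
      using exp_ge_add_one_self[of "r * t - 1"] by simp
    then have "exp (- (r * t)) * (r * t) \<le> exp (- (r * t)) * exp (r * t - 1)"
      by (intro mult_left_mono) auto
    also have "\<dots> = exp (- 1)" by (simp flip: exp_add)
    finally show ?thesis using r by (simp add: field_simps)
  qed
  ultimately show ?thesis by linarith
qed (use r in simp)

lemma powr_ceiling_diff_le:
  fixes u r :: real
  assumes u: "0 \<le> u" "u \<le> 1" and r: "0 < r"
  shows "\<bar>u powr r - u ^ nat \<lceil>r\<rceil>\<bar> \<le> 3 * exp (- 1) * of_bool (r \<notin> \<nat>) / r"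
proof -
  have R: "r \<le> real (nat \<lceil>r\<rceil>)" "real (nat \<lceil>r\<rceil>) \<le> r + 1"
    using r by linarith+
  \<comment> \<open>At \<open>u = 0\<close> the two powers agree only for a nonzero exponent, since
    \<open>0 ^ 0 = 1\<close> but \<open>0 powr 0 = 0\<close>; positivity of \<open>r\<close> makes
    the ceiling positive.\<close>
  then have pw: "u ^ nat \<lceil>r\<rceil> = u powr real (nat \<lceil>r\<rceil>)"
    using u r by (cases "u = 0") (auto simp del: of_nat_nat simp flip: powr_realpow)
  show ?thesis
  proof (cases "r \<in> \<nat>")
    case True
    then have "real (nat \<lceil>r\<rceil>) = r" by (auto elim: Nats_cases)
    with True pw show ?thesis by simp
  next
    case False
    have "exp (- 1) / r \<le> 3 * exp (- 1) / r"
      using r by (intro divide_right_mono) auto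
    with False powr_diff_le_inverse_exponent[OF u r R] pw show ?thesis by simp
  qed
qed

lemma gev_cdf_bounds: "0 \<le> gev_cdf \<xi> \<mu> \<sigma> x" "gev_cdf \<xi> \<mu> \<sigma> x \<le> 1"
  by (auto simp: gev_cdf_def)

lemma running_max_le_iff:
  assumes "n \<ge> 1"
  shows "running_max X n \<omega> \<le> y \<longleftrightarrow> (\<forall>i\<in>{1..n}. X i \<omega> \<le> y)"
  using assms by (auto simp: running_max_def)

lemma copula_diagonal_bounds:
  assumes "is_copula n C" "0 \<le> u" "u \<le> 1"
  shows "0 \<le> copula_diagonal n C u" "copula_diagonal n C u \<le> 1"
proof -
  obtain Q where "prob_space Q"
    and C: "\<forall>u\<in>unit_cube n. C u = measure Q {\<omega> \<in> space Q. \<forall>i\<in>{1..n}. \<omega> i \<le> u i}"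
    using assms(1) unfolding is_copula_def by blast
  interpret prob_space Q by fact
  have "(\<lambda>i\<in>{1..n}. u) \<in> unit_cube n"
    using assms by (auto simp: unit_cube_def)
  with C show "0 \<le> copula_diagonal n C u" "copula_diagonal n C u \<le> 1"
    by (simp_all only: copula_diagonal_def measure_nonneg prob_le_1)
qed

text \<open>At two distinct points \<open>K\<close> times a positive number dominates an absolute
  value. The sign is needed later to multiply inequalities by \<open>K\<close>.\<close>

lemma holder_continuous_on_constant_nonneg:
  assumes "holder_continuous_on S f K \<kappa>" "u \<in> S" "v \<in> S" "u \<noteq> v"
  shows "0 \<le> K"
proof -
  have "0 \<le> K * \<bar>u - v\<bar> powr \<kappa>"
    using assms unfolding holder_continuous_on_def by (meson abs_ge_zero order_trans)
  with assms(4) show ?thesis by (simp add: zero_le_mult_iff)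
qed

context
  fixes M :: "'a measure" and X :: "nat \<Rightarrow> 'a \<Rightarrow> real" and F :: "real \<Rightarrow> real" and n :: nat
  assumes M: "prob_space M" and n: "n \<ge> 1"
    and X: "\<And>i. i \<ge> 1 \<Longrightarrow> X i \<in> borel_measurable M"
    and F: "\<And>i. i \<ge> 1 \<Longrightarrow> cdf (distr M borel (X i)) = F" and cont: "continuous_on UNIV F"
begin

text \<open>Existence and uniqueness of the copula turn the definite description into its
  characteristic property.\<close>

lemma copula_of:
  shows is_copula_copula_of: "is_copula n (copula_of M X F n)"
    and measure_eq_copula_of:
      "measure M {\<omega> \<in> space M. \<forall>i\<in>{1..n}. X i \<omega> \<le> x i} = copula_of M X F n (\<lambda>i\<in>{1..n}. F (x i))"
  using theI'[OF copula_ex1[of M n X F, OF M n X F cont]] unfolding copula_of_def by blast+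

lemma common_cdf_bounds: "0 \<le> F x" "F x \<le> 1"
proof -
  interpret D: real_distribution "distr M borel (X 1)"
    using M X by (simp add: prob_space.real_distribution_distr)
  show "0 \<le> F x" "F x \<le> 1"
    using D.cdf_nonneg D.cdf_bounded_prob by (simp_all flip: F[of 1])
qed

text \<open>These bounds make the supremum in the distortion hypothesis one over a bounded family,
  so that it controls each single \<open>u\<close>.\<close>

lemma diagonal_power_distortion_bounds:
  assumes "0 \<le> u" "u \<le> 1" "0 < r n"
  shows "0 \<le> diagonal_power_distortion M X F r n u" "diagonal_power_distortion M X F r n u \<le> 1"
  using copula_diagonal_bounds[OF is_copula_copula_of, of "u powr (1 / r n)"] assms
  by (simp_all add: diagonal_power_distortion_def powr_le1)

text \<open>The maximum is at most \<open>y\<close> exactly when all variables are, so the copula is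
  evaluated on its diagonal at \<open>F y\<close>; the root inside the distortion cancels the power
  \<open>r n\<close>.\<close>

lemma measure_running_max_eq_distortion:
  assumes "0 < r n"
  shows "measure M {\<omega> \<in> space M. running_max X n \<omega> \<le> y}
    = diagonal_power_distortion M X F r n (F y powr r n)"
  using measure_eq_copula_of[of "\<lambda>_. y"] assms common_cdf_bounds[of y]
  by (simp add: running_max_le_iff[OF n] diagonal_power_distortion_def copula_diagonal_def powr_powr)

end

theorem theorem5p1:
  fixes M :: "'a measure" and X :: "nat \<Rightarrow> 'a \<Rightarrow> real" and F :: "real \<Rightarrow> real"
    and H :: "real \<Rightarrow> real" and \<xi> \<mu> \<sigma> :: real
    and c d \<beta> r s :: "nat \<Rightarrow> real" and D :: "real \<Rightarrow> real" and K \<kappa> :: real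
  assumes prob: "prob_space M"
    and rv: "\<And>i. i \<ge> 1 \<Longrightarrow> X i \<in> borel_measurable M"
    and df: "\<And>i. i \<ge> 1 \<Longrightarrow> cdf (distr M borel (X i)) = F"
    and cont: "continuous_on UNIV F"
    \<comment> \<open>(i)\<close>
    and gev: "\<sigma> > 0" "H = gev_cdf \<xi> \<mu> \<sigma>"
    and c_pos: "\<And>n. n \<ge> 1 \<Longrightarrow> c n > 0"
    and beta_nonneg: "\<And>n. n \<ge> 1 \<Longrightarrow> \<beta> n \<ge> 0"
    and beta_lim: "\<beta> \<longlonglongrightarrow> 0"
    and iid_rate: "\<And>n. n \<ge> 1 \<Longrightarrow> (SUP x. \<bar>F (c n * x + d n) ^ n - H x\<bar>) \<le> \<beta> n"
    \<comment> \<open>(ii)\<close>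
    and r_pos: "\<And>n. n \<ge> 1 \<Longrightarrow> r n > 0"
    and r_lim: "filterlim r at_top sequentially"
    and D_range: "D \<in> {0..1} \<rightarrow> {0..1}"
    and s_nonneg: "\<And>n. n \<ge> 1 \<Longrightarrow> s n \<ge> 0"
    and s_lim: "s \<longlonglongrightarrow> 0"
    and distortion_rate:
      "\<And>n. n \<ge> 1 \<Longrightarrow> (SUP u\<in>{0..1}. \<bar>diagonal_power_distortion M X F r n u - D u\<bar>) \<le> s n"
    \<comment> \<open>(iii)\<close>
    and kappa: "0 < \<kappa>" "\<kappa> \<le> 1"
    and holder: "holder_continuous_on {0..1} D K \<kappa>"
  shows "(\<forall>n\<ge>1.
            (SUP x. \<bar>measure M {\<omega> \<in> space M. running_max X n \<omega> \<le> c (nat \<lceil>r n\<rceil>) * x + d (nat \<lceil>r n\<rceil>)}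
                      - (D \<circ> H) x\<bar>)
            \<le> K * (\<beta> (nat \<lceil>r n\<rceil>) + 3 * exp (- 1) * of_bool (r n \<notin> \<nat>) / r n) powr \<kappa> + s n)
       \<and> (\<lambda>n. K * (\<beta> (nat \<lceil>r n\<rceil>) + 3 * exp (- 1) * of_bool (r n \<notin> \<nat>) / r n) powr \<kappa> + s n)
            \<longlonglongrightarrow> 0"
proof (intro conjI allI impI)
  let ?R = "\<lambda>n. nat \<lceil>r n\<rceil>"
  have H01: "0 \<le> H x" "H x \<le> 1" for x
    by (simp_all add: gev gev_cdf_bounds)
  have F01: "0 \<le> F x" "F x \<le> 1" for x
    using common_cdf_bounds[of M 1 X F, OF prob _ rv df cont] by simp_all
  have K: "0 \<le> K"
    using holder_continuous_on_constant_nonneg[OF holder, of 0 1] by simp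

  fix n :: nat assume n: "n \<ge> 1"
  note rn = r_pos[OF n]
  show "(SUP x. \<bar>measure M {\<omega> \<in> space M. running_max X n \<omega> \<le> c (?R n) * x + d (?R n)} - (D \<circ> H) x\<bar>)
    \<le> K * (\<beta> (?R n) + 3 * exp (- 1) * of_bool (r n \<notin> \<nat>) / r n) powr \<kappa> + s n"
  proof (rule cSUP_least)
    fix x
    define y where "y = c (?R n) * x + d (?R n)"
    define u where "u = F y powr r n"
    have u: "u \<in> {0..1}" using F01[of y] rn by (simp add: u_def powr_le1)
    \<comment> \<open>A bound on a real \<open>SUP\<close> yields pointwise bounds only once the
      family is known to be bounded above; here all values lie in the unit interval.\<close>
    have "\<bar>diagonal_power_distortion M X F r n u - D u\<bar>
        \<le> (SUP u\<in>{0..1}. \<bar>diagonal_power_distortion M X F r n u - D u\<bar>)"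
    proof (rule cSUP_upper[OF u])
      have "\<bar>diagonal_power_distortion M X F r n v - D v\<bar> \<le> 1" if "v \<in> {0..1}" for v
        using diagonal_power_distortion_bounds[of M n X F v r, OF prob n rv df cont] that rn
          funcset_mem[OF D_range that] by auto
      then show "bdd_above ((\<lambda>u. \<bar>diagonal_power_distortion M X F r n u - D u\<bar>) ` {0..1})"
        by (rule bdd_aboveI2)
    qed
    also have "\<dots> \<le> s n" by (rule distortion_rate[OF n])
    finally have dist: "\<bar>diagonal_power_distortion M X F r n u - D u\<bar> \<le> s n" .

    \<comment> \<open>Assumption (i) is available from index 1 on, and the ceiling of a positive
      rate is such an index.\<close>
    have R1: "?R n \<ge> 1" using rn by linarith
    have "\<bar>F y ^ ?R n - H x\<bar> \<le> (SUP x. \<bar>F (c (?R n) * x + d (?R n)) ^ ?R n - H x\<bar>)"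
      unfolding y_def
    proof (rule cSUP_upper[OF UNIV_I])
      have "\<bar>F z ^ ?R n - H x\<bar> \<le> 1" for z x
        using H01[of x] zero_le_power[OF F01(1)[of z], of "?R n"]
          power_le_one[OF F01[of z], of "?R n"] by linarith
      then show "bdd_above (range (\<lambda>x. \<bar>F (c (?R n) * x + d (?R n)) ^ ?R n - H x\<bar>))"
        by (rule bdd_aboveI2)
    qed
    also have "\<dots> \<le> \<beta> (?R n)" by (rule iid_rate[OF R1])
    \<comment> \<open>Triangle inequality through the integer power \<open>F y ^ ?R n\<close>, which
      lies between the real power \<open>u\<close> and the limit \<open>H x\<close>in the chain of
      comparisons.\<close>
    finally have "\<bar>u - H x\<bar> \<le> \<beta> (?R n) + 3 * exp (- 1) * of_bool (r n \<notin> \<nat>) / r n"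
      using powr_ceiling_diff_le[OF F01[of y] rn] unfolding u_def by linarith
    then have "K * \<bar>u - H x\<bar> powr \<kappa>
        \<le> K * (\<beta> (?R n) + 3 * exp (- 1) * of_bool (r n \<notin> \<nat>) / r n) powr \<kappa>"
      using K kappa by (intro mult_left_mono powr_mono2) auto
    moreover have "\<bar>D u - D (H x)\<bar> \<le> K * \<bar>u - H x\<bar> powr \<kappa>"
      using holder u H01[of x] unfolding holder_continuous_on_def by simp
    moreover have "measure M {\<omega> \<in> space M. running_max X n \<omega> \<le> y} = diagonal_power_distortion M X F r n u"
      unfolding u_def by (rule measure_running_max_eq_distortion[of M n X F r, OF prob n rv df cont rn])
    ultimately show "\<bar>measure M {\<omega> \<in> space M. running_max X n \<omega> \<le> c (?R n) * x + d (?R n)} - (D \<circ> H) x\<bar>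
        \<le> K * (\<beta> (?R n) + 3 * exp (- 1) * of_bool (r n \<notin> \<nat>) / r n) powr \<kappa> + s n"
      using dist unfolding comp_def y_def by linarith
  qed simp
next
  let ?R = "\<lambda>n. nat \<lceil>r n\<rceil>"
  let ?b = "\<lambda>n. \<beta> (?R n) + 3 * exp (- 1) * of_bool (r n \<notin> \<nat>) / r n"
  \<comment> \<open>The ceiling diverges because it dominates the floor, which diverges with
    \<open>r\<close>.\<close>
  have "filterlim (\<lambda>n. nat \<lfloor>r n\<rfloor>) at_top sequentially"
    by (rule filterlim_compose[OF filterlim_nat_sequentially
          filterlim_compose[OF filterlim_floor_sequentially r_lim]])
  then have "filterlim ?R at_top sequentially"
    by (rule filterlim_at_top_mono) (auto intro!: always_eventually nat_mono floor_le_ceiling)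
  then have \<beta>R: "(\<lambda>n. \<beta> (?R n)) \<longlonglongrightarrow> 0"
    by (rule filterlim_compose[OF beta_lim])
  have "(\<lambda>n. 3 * exp (- 1) * of_bool (r n \<notin> \<nat>) / r n) \<longlonglongrightarrow> 0"
  \<comment> \<open>The indicator may oscillate, so it is bounded by 1 before passing to the
    limit.\<close>
  proof (rule Lim_null_comparison)
    show "(\<lambda>n. 3 * exp (- 1) / r n) \<longlonglongrightarrow> 0"
      by (rule tendsto_divide_0[OF tendsto_const filterlim_at_top_imp_at_infinity[OF r_lim]])
    show "eventually (\<lambda>n. norm (3 * exp (- 1) * of_bool (r n \<notin> \<nat>) / r n) \<le> 3 * exp (- 1) / r n) sequentially"
      using eventually_ge_at_top[of 1] by eventually_elim (auto simp: r_pos less_imp_le)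
  qed
  from tendsto_add[OF \<beta>R this] have "?b \<longlonglongrightarrow> 0" by simp
  \<comment> \<open>The base tends to 0, where \<open>powr\<close> is continuous only from the
    right; eventual nonnegativity together with \<open>\<kappa> > 0\<close> secures the
    limit.\<close>
  moreover have "eventually (\<lambda>n. 0 \<le> ?b n) sequentially"
    using eventually_ge_at_top[of 1]
  proof eventually_elim
    case (elim n)
    then have "?R n \<ge> 1" "0 \<le> r n" using r_pos[of n] by linarith+
    then show ?case by (intro add_nonneg_nonneg beta_nonneg) auto
  qed
  ultimately have "(\<lambda>n. ?b n powr \<kappa>) \<longlonglongrightarrow> 0 powr \<kappa>"
    using kappa by (intro tendsto_powr') auto
  then have "(\<lambda>n. K * ?b n powr \<kappa> + s n) \<longlonglongrightarrow> K * 0 powr \<kappa> + 0"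
    by (intro tendsto_add tendsto_mult tendsto_const s_lim)
  then show "(\<lambda>n. K * ?b n powr \<kappa> + s n) \<longlonglongrightarrow> 0" by simp
qed

end
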